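(* For each $n\ge 1$ let $\xi^{(n)}_1,\dots,\xi^{(n)}_n$ be the zeros of the $n$-th monic (probabilists') Hermite polynomial $H_n$, let $\lambda^{(n)}_j=\frac{\xi^{(n)}_j}{2\sqrt n}$ for $1\le j\le n$, and let $\mu_n=\frac1n\sum_{j=1}^n\delta_{\lambda^{(n)}_j}$ be the empirical distribution of the normalized zeros. Then, as $n\to\infty$, the probability measures $\mu_n$ converge weakly to the semicircle distribution $\rho_{sc}(x)\,dx$ on $\mathbb{R}$, where $\rho_{sc}(x)=\frac{2}{\pi}\sqrt{1-x^2}\cdot\mathbf{1}_{[-1,1]}(x)$.
   Context: The $n$-th monic (probabilists') Hermite polynomial is $H_n(x)=\sum_{k=0}^{\lfloor n/2\rfloor}(-1)^k\binom{n}{2k}(2k-1)!!\,x^{n-2k}$ (with $(-1)!!=1$); equivalently $H_0(x)=1$, $H_1(x)=x$, $H_{n+1}(x)=xH_n(x)-nH_{n-1}(x)$. All zeros of $H_n$ are real. $\delta_a$ denotes the Dirac measure at $a$ and $\mathbf{1}_{[-1,1]}$ the indicator function of $[-1,1]$ (so $\rho_{sc}$ is $0$ outside $[-1,1]$). *)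

theory Defs
  imports "HOL-Probability.Probability" "HOL-Computational_Algebra.Polynomial"
begin

text \<open>The empty product at \<open>k = 0\<close> is the convention \<open>(-1)!! = 1\<close>.\<close>

definition odd_double_fact :: "nat \<Rightarrow> nat" where
  "odd_double_fact k = (\<Prod>i=1..k. 2 * i - 1)"

definition hermite :: "nat \<Rightarrow> real poly" where
  "hermite n = (\<Sum>k=0..n div 2.
     monom ((-1) ^ k * real (n choose (2 * k)) * real (odd_double_fact k)) (n - 2 * k))"

lemma hermite_eq_sum:
  assumes "n \<le> N"
  shows "hermite n = (\<Sum>k\<le>N.
     monom ((-1) ^ k * real (n choose (2 * k)) * real (odd_double_fact k)) (n - 2 * k))"
  unfolding hermite_def using assms
  by (intro sum.mono_neutral_left) (auto simp: binomial_eq_0)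

lemma hermite_0: "hermite 0 = 1"
  by (simp add: hermite_def odd_double_fact_def)

lemma hermite_1: "hermite (Suc 0) = [:0, 1:]"
  by (simp add: hermite_def odd_double_fact_def monom_altdef)

lemma hermite_Suc_Suc:
  "hermite (Suc (Suc n)) = [:0, 1:] * hermite (Suc n) - of_nat (Suc n) * hermite n"
proof -
  define c where "c n k = (-1) ^ k * real (n choose (2 * k)) * real (odd_double_fact k)" for n k
  have step: "monom (c (Suc (Suc n)) (Suc k)) (Suc (Suc n) - 2 * Suc k) =
     [:0, 1:] * monom (c (Suc n) (Suc k)) (Suc n - 2 * Suc k)
     - of_nat (Suc n) * monom (c n k) (n - 2 * k)" for k
  proof -
    have binom: "Suc (2 * k) * (Suc n choose Suc (2 * k)) = Suc n * (n choose (2 * k))"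
      using Suc_times_binomial[of "2 * k" n] by (simp only: ac_simps)
    have dfact: "odd_double_fact (Suc k) = odd_double_fact k * Suc (2 * k)"
      by (simp add: odd_double_fact_def)
    have pascal: "(Suc (Suc n) choose (2 * Suc k)) = (Suc n choose Suc (2 * k)) + (Suc n choose (2 * Suc k))"
      by simp
    have "(Suc n choose Suc (2 * k)) * odd_double_fact (Suc k) =
        Suc n * (n choose (2 * k)) * odd_double_fact k"
      unfolding dfact binom[symmetric] by (simp only: ac_simps)
    then have *: "real (Suc n choose Suc (2 * k)) * real (odd_double_fact (Suc k)) =
        real (Suc n) * real (n choose (2 * k)) * real (odd_double_fact k)"
      by (metis of_nat_mult)
    have c: "c (Suc (Suc n)) (Suc k) = c (Suc n) (Suc k) - real (Suc n) * c n k"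
    proof -
      have "c (Suc (Suc n)) (Suc k) = c (Suc n) (Suc k)
          + (-1) ^ Suc k * (real (Suc n choose Suc (2 * k)) * real (odd_double_fact (Suc k)))"
        unfolding c_def pascal of_nat_add by (simp only: distrib_left distrib_right ac_simps)
      then show ?thesis
        unfolding * by (simp add: c_def)
    qed
    have shift: "[:0, 1:] * monom (c (Suc n) (Suc k)) (Suc n - 2 * Suc k) =
        monom (c (Suc n) (Suc k)) (n - 2 * k)"
    proof (cases "2 * Suc k \<le> Suc n")
      case True
      then have "n - 2 * k = Suc (Suc n - 2 * Suc k)" by simp
      then show ?thesis by (simp only: monom_Suc) simp
    next
      case False
      then have "c (Suc n) (Suc k) = 0" by (simp add: c_def binomial_eq_0 del: binomial_Suc_Suc)
      then show ?thesis by simp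
    qed
    show ?thesis
      unfolding shift c by (simp add: of_nat_poly smult_monom diff_monom algebra_simps)
  qed
  have first: "monom (c (Suc (Suc n)) 0) (Suc (Suc n)) = [:0, 1:] * monom (c (Suc n) 0) (Suc n)"
    by (simp add: c_def monom_Suc)
  have H: "hermite (Suc m) = monom (c (Suc m) 0) (Suc m) +
      (\<Sum>k\<le>Suc n. monom (c (Suc m) (Suc k)) (Suc m - 2 * Suc k))" if "m \<le> Suc n" for m
    using that hermite_eq_sum[of "Suc m" "Suc (Suc n)"]
    unfolding c_def[symmetric] by (simp only: sum.atMost_Suc_shift) simp
  have H0: "hermite n = (\<Sum>k\<le>Suc n. monom (c n k) (n - 2 * k))"
    unfolding c_def by (rule hermite_eq_sum) simp
  show ?thesis
    unfolding H[OF order_refl] H[OF le_SucI[OF order_refl]] H0 step first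
    by (simp only: sum_subtractf sum_distrib_left distrib_left add_diff_eq)
qed

text \<open>The zeros with multiplicity, in increasing order. The list has length \<open>n\<close> because all
  zeros are real; for a list that is too short, \<open>nth\<close> would be unspecified.\<close>

definition hermite_zero :: "nat \<Rightarrow> nat \<Rightarrow> real" where
  "hermite_zero n j = sorted_list_of_multiset (proots (hermite n)) ! (j - 1)"

definition normalized_zero :: "nat \<Rightarrow> nat \<Rightarrow> real" where
  "normalized_zero n j = hermite_zero n j / (2 * sqrt (real n))"

definition empirical_measure :: "nat \<Rightarrow> (nat \<Rightarrow> real) \<Rightarrow> real measure" where
  "empirical_measure n x =
     measure_of UNIV (sets borel)
       (\<lambda>A. ennreal (1 / real n) * (\<Sum>j=1..n. emeasure (return borel (x j)) A))"

lemma space_empirical_measure [simp]: "space (empirical_measure n x) = UNIV"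
  by (simp add: empirical_measure_def space_measure_of_conv)

lemma sets_empirical_measure [simp]: "sets (empirical_measure n x) = sets borel"
  unfolding empirical_measure_def 
  by (metis sets.sigma_sets_eq sets.space_closed sets_measure_of space_borel)

lemma emeasure_empirical_measure:
  assumes "A \<in> sets borel"
  shows "emeasure (empirical_measure n x) A =
    ennreal (1 / real n) * (\<Sum>j=1..n. emeasure (return borel (x j)) A)"
proof (rule emeasure_measure_of[OF empirical_measure_def])
  show "countably_additive (sets (empirical_measure n x))
    (\<lambda>A. ennreal (1 / real n) * (\<Sum>j=1..n. emeasure (return borel (x j)) A))"
  proof (rule countably_additiveI)
    fix F :: "nat \<Rightarrow> real set"
    assume F: "range F \<subseteq> sets (empirical_measure n x)" "disjoint_family F"
    then have "(\<Sum>i. emeasure (return borel (x j)) (F i)) = emeasure (return borel (x j)) (\<Union>(range F))" for j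
      by (intro suminf_emeasure) auto
    then show "(\<Sum>i. ennreal (1 / real n) * (\<Sum>j=1..n. emeasure (return borel (x j)) (F i))) =
      ennreal (1 / real n) * (\<Sum>j=1..n. emeasure (return borel (x j)) (\<Union>(range F)))"
      by (simp add: ennreal_suminf_cmult suminf_sum)
  qed
qed (use assms in \<open>auto simp: positive_def\<close>)

lemma real_distribution_empirical_measure:
  assumes "n \<ge> 1"
  shows "real_distribution (empirical_measure n x)"
proof -
  have "emeasure (empirical_measure n x) UNIV = ennreal (1 / real n) * ennreal (real n)"
    by (simp add: emeasure_empirical_measure ennreal_of_nat_eq_real_of_nat)
  also have "\<dots> = 1"
    using assms by (simp flip: ennreal_mult)
  finally have "prob_space (empirical_measure n x)"
    by (intro prob_spaceI) simp
  then show ?thesis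
    by (intro real_distribution.intro real_distribution_axioms.intro) auto
qed

definition semicircle_density :: "real \<Rightarrow> real" where
  "semicircle_density x = 2 / pi * sqrt (1 - x\<^sup>2) * indicator {-1..1} x"

definition semicircle :: "real measure" where
  "semicircle = density lborel (\<lambda>x. ennreal (semicircle_density x))"

lemma real_distribution_semicircle: "real_distribution semicircle"
proof -
  define G where "G x = (x * sqrt (1 - x\<^sup>2) + arcsin x) / pi" for x :: real
  have der: "(G has_vector_derivative 2 / pi * sqrt (1 - x\<^sup>2)) (at x)" if "x \<in> {-1<..<1}" for x
  proof -
    have x: "x\<^sup>2 < 1" using that by (simp add: abs_square_less_1 abs_less_iff)
    have "(G has_real_derivative
        (sqrt (1 - x\<^sup>2) + x * (- 2 * x * (inverse (sqrt (1 - x\<^sup>2)) / 2)) + inverse (sqrt (1 - x\<^sup>2))) / pi) (at x)"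
      unfolding G_def using that x
      by (auto intro!: derivative_eq_intros simp: divide_simps)
    moreover have "sqrt (1 - x\<^sup>2) + x * (- 2 * x * (inverse (sqrt (1 - x\<^sup>2)) / 2)) + inverse (sqrt (1 - x\<^sup>2))
        = 2 * sqrt (1 - x\<^sup>2)"
    proof -
      define s where "s = sqrt (1 - x\<^sup>2)"
      have s: "s > 0" "x * x = 1 - s * s" using x by (auto simp: s_def power2_eq_square)
      then show ?thesis unfolding s_def[symmetric] by (simp add: field_simps)
    qed
    ultimately have "(G has_real_derivative 2 * sqrt (1 - x\<^sup>2) / pi) (at x)"
      by (simp only:)
    then show ?thesis
      by (simp add: has_real_derivative_iff_has_vector_derivative)
  qed
  have cont: "continuous_on {-1..1} G"
    unfolding G_def by (intro continuous_intros continuous_on_arcsin) auto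
  have "((\<lambda>x. 2 / pi * sqrt (1 - x\<^sup>2)) has_integral G 1 - G (-1)) {-1..1}"
    by (rule fundamental_theorem_of_calculus_interior[OF _ cont der]) auto
  then have int: "((\<lambda>x. 2 / pi * sqrt (1 - x\<^sup>2)) has_integral 1) {-1..1}"
    by (simp add: G_def)
  have nonneg: "2 / pi * sqrt (1 - x\<^sup>2) \<ge> 0" if "x \<in> {-1..1}" for x :: real
    using that by (simp add: abs_square_le_1 abs_le_iff)
  have "emeasure semicircle UNIV = (\<integral>\<^sup>+x. ennreal (semicircle_density x) \<partial>lborel)"
    unfolding semicircle_def
    by (subst emeasure_density) (auto simp: semicircle_density_def)
  also have "\<dots> = 1"
    using nn_integral_has_integral_lebesgue[OF nonneg int]
    by (simp add: nn_integral_completion semicircle_density_def mult.commute)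
  finally have "prob_space semicircle"
    by (intro prob_spaceI) (simp add: semicircle_def)
  then show ?thesis
    by (intro real_distribution.intro real_distribution_axioms.intro) (auto simp: semicircle_def)
qed

end

theory Submission
  imports Defs "HOL-Computational_Algebra.Fundamental_Theorem_Algebra"
begin

text \<open>
  The differential equation \<open>H'' - x H' + n H = 0\<close> says that the zeros are in electrostatic
  equilibrium: the normalized zeros satisfy \<open>\<Sum>\<^sub>b\<^sub>\<noteq>\<^sub>a 1 / (a - b) = 2 n a\<close>. Multiplying by \<open>f(a)\<close>,
  summing over \<open>a\<close> and symmetrising gives the loop equation
  \<open>4 \<integral> x f(x) d\<mu>\<^sub>n = \<integral>\<integral> (f(x) - f(y)) / (x - y) d\<mu>\<^sub>n d\<mu>\<^sub>n + O(1 / n)\<close>. For \<open>f = U\<^sub>k\<close>, a Chebyshev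
  polynomial of the second kind, the difference quotient is \<open>2 \<Sum>\<^sub>l U\<^sub>l(x) U\<^sub>k\<^sub>-\<^sub>1\<^sub>-\<^sub>l(y)\<close>, so induction
  on \<open>k\<close> yields \<open>\<integral> U\<^sub>k d\<mu>\<^sub>n \<longlonglongrightarrow> 0\<close> for \<open>k \<ge> 1\<close>. The semicircle law is the measure on \<open>[-1, 1]\<close> for
  which these integrals vanish. As all \<open>\<mu>\<^sub>n\<close> live on \<open>[-1, 1]\<close>, the Weierstrass approximation
  theorem finishes the proof.
\<close>

section \<open>Zeros of the Hermite polynomials\<close>

lemma poly_hermite_Suc_Suc:
  "poly (hermite (Suc (Suc n))) x = x * poly (hermite (Suc n)) x - real (Suc n) * poly (hermite n) x"
  by (simp add: hermite_Suc_Suc del: of_nat_Suc)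

lemma degree_hermite_monic: "degree (hermite n) = n \<and> coeff (hermite n) n = 1"
proof (induction n rule: induct_nat_012)
  case (ge2 n)
  have "hermite (Suc n) \<noteq> 0" using ge2 by auto
  then have d: "degree ([:0, 1:] * hermite (Suc n)) = Suc (Suc n)"
    using ge2 by (simp add: degree_mult_eq)
  have l: "degree (of_nat (Suc n) * hermite n) < Suc (Suc n)"
    using ge2 by (metis degree_mult_le degree_of_nat add_0 le_imp_less_Suc less_SucI)
  have "degree (hermite (Suc (Suc n))) = Suc (Suc n)"
    unfolding hermite_Suc_Suc using degree_add_eq_left[of "- (of_nat (Suc n) * hermite n)"] d l
    by simp
  moreover have "coeff (of_nat (Suc n) * hermite n) (Suc (Suc n)) = 0"
    using l by (rule coeff_eq_0)
  ultimately show ?case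
    using ge2 by (simp add: hermite_Suc_Suc)
qed (auto simp: hermite_0 hermite_1)

lemma hermite_nonzero [simp]: "hermite n \<noteq> 0"
  using degree_hermite_monic[of n] by auto

text \<open>The Appell property, obtained by differentiating the recurrence. It turns facts about
  derivatives into facts about neighbouring Hermite polynomials.\<close>

lemma pderiv_hermite: "pderiv (hermite (Suc n)) = of_nat (Suc n) * hermite n"
proof (induction n rule: induct_nat_012)
  case (ge2 n)
  show ?case
    unfolding hermite_Suc_Suc[of "Suc n"] pderiv_diff pderiv_mult ge2
    by (simp add: pderiv_pCons hermite_Suc_Suc[of n] pderiv_add algebra_simps)
qed (simp_all add: hermite_0 hermite_1 hermite_Suc_Suc pderiv_pCons pderiv_mult pderiv_diff one_pCons)

text \<open>Read downwards, the recurrence would carry a common zero of two neighbours all the way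
  to \<open>hermite 0\<close>, which is the constant 1.\<close>

lemma no_common_zero_hermite:
  assumes "poly (hermite (Suc n)) x = 0"
  shows "poly (hermite n) x \<noteq> 0"
  using assms
proof (induction n)
  case (Suc n)
  show ?case
  proof
    assume z: "poly (hermite (Suc n)) x = 0"
    with Suc.prems have "poly (hermite n) x = 0" 
      by (simp add: poly_hermite_Suc_Suc del: of_nat_Suc)
    with Suc.IH z show False by simp
  qed
qed (simp add: hermite_0)

text \<open>By the Appell property, a multiple zero would be a common zero of two consecutive
  Hermite polynomials.\<close>

lemma rsquarefree_hermite: "rsquarefree (hermite n)"
proof (cases n)
  case 0
  then show ?thesis by (simp add: hermite_0 rsquarefree_roots)
next
  case (Suc m)
  show ?thesis
    unfolding rsquarefree_roots Suc pderiv_hermite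
    using no_common_zero_hermite[of m] by (auto simp del: of_nat_Suc)
qed

text \<open>The Hermite differential equation where its term \<open>n * H\<close> vanishes. With the
  Appell property it is the recurrence for \<open>hermite n\<close> at a zero, multiplied by
  \<open>n\<close>.\<close>

lemma hermite_ode_at_zero:
  assumes "poly (hermite n) x = 0"
  shows "poly (pderiv (pderiv (hermite n))) x = x * poly (pderiv (hermite n)) x"
proof (cases n)
  case 0
  then show ?thesis by (simp add: hermite_0)
next
  case (Suc m)
  show ?thesis
  proof (cases m)
    case 0
    then show ?thesis using assms Suc by (simp add: hermite_1 pderiv_pCons)
  next
    case (Suc k)
    have "x * poly (hermite (Suc k)) x = real (Suc k) * poly (hermite k) x"
      using assms unfolding \<open>n = Suc m\<close> Suc poly_hermite_Suc_Suc by simp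
    then show ?thesis unfolding \<open>n = Suc m\<close> Suc
      by (simp add: pderiv_hermite pderiv_mult pderiv_of_nat del: of_nat_Suc)
  qed
qed

section \<open>Reality of the zeros\<close>

lemma map_poly_of_real_diff:
  "map_poly of_real (p - q) = map_poly of_real p - (map_poly of_real q :: 'a :: real_algebra_1 poly)"
  by (rule poly_eqI) (simp add: coeff_map_poly)

lemma map_poly_of_real_mult:
  "map_poly of_real (p * q) = map_poly of_real p * (map_poly of_real q :: 'a :: {real_algebra_1, comm_ring_1} poly)"
  by (rule poly_eqI) (simp add: coeff_map_poly coeff_mult)

text \<open>The Wronskian-type expression \<open>H\<^sub>n\<^sub>+\<^sub>1(z) H\<^sub>n(z\<^sup>*) - H\<^sub>n\<^sub>+\<^sub>1(z\<^sup>*) H\<^sub>n(z)\<close> of the Christoffel--Darboux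
  formula (\<open>z\<^sup>*\<close> the conjugate) is \<open>z - z\<^sup>*\<close> times a positive number, which forces every complex zero to be real.\<close>

lemma Im_hermite_Christoffel_Darboux:
  "\<exists>c>0. Im (poly (map_poly of_real (hermite (Suc n))) z * cnj (poly (map_poly of_real (hermite n)) z))
     = Im z * c"
proof (induction n)
  case 0
  show ?case
    by (intro exI[of _ 1]) (simp add: hermite_0 hermite_1 map_poly_pCons)
next
  case (Suc n)
  define h where "h k = poly (map_poly complex_of_real (hermite k)) z" for k
  have rec: "h (Suc (Suc n)) = z * h (Suc n) - of_real (real (Suc n)) * h n"
    by (simp add: h_def hermite_Suc_Suc map_poly_of_real_diff map_poly_of_real_mult map_poly_pCons of_nat_poly
        del: of_nat_Suc mult_pCons_left)
  from Suc obtain c where c: "c > 0" "Im (h (Suc n) * cnj (h n)) = Im z * c"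
    by (auto simp: h_def)
  have "Im (h (Suc (Suc n)) * cnj (h (Suc n))) =
      Im z * (cmod (h (Suc n)))\<^sup>2 + real (Suc n) * Im (h (Suc n) * cnj (h n))"
    unfolding rec cmod_power2 by (simp add: power2_eq_square algebra_simps)
  also have "\<dots> = Im z * ((cmod (h (Suc n)))\<^sup>2 + real (Suc n) * c)"
    unfolding c by (simp add: algebra_simps)
  finally show ?case
    using c(1) unfolding h_def
    by (intro exI[of _ "(cmod (h (Suc n)))\<^sup>2 + real (Suc n) * c"])
       (auto simp: h_def intro!: add_nonneg_pos)
qed

lemma hermite_complex_zero_real:
  assumes "poly (map_poly of_real (hermite n)) (z :: complex) = 0"
  shows "Im z = 0"
proof (cases n)
  case 0
  then show ?thesis using assms by (simp add: hermite_0)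
next
  case (Suc m)
  then show ?thesis using assms Im_hermite_Christoffel_Darboux[of m z] by auto
qed

lemma poly_of_real_conv:
  "poly (map_poly of_real p) (of_real x :: 'a :: {real_algebra_1, comm_ring_1}) = of_real (poly p x)"
  by (induction p) (auto simp: map_poly_pCons)

text \<open>The fundamental theorem of algebra gives a complex root, which is real by assumption.
  The real linear factor splits off, and the quotient inherits the assumption because its roots are
  roots of \<open>p\<close>.\<close>

lemma size_proots_real_rooted:
  fixes p :: "real poly"
  assumes "p \<noteq> 0" and "\<And>z :: complex. poly (map_poly of_real p) z = 0 \<Longrightarrow> Im z = 0"
  shows "size (proots p) = degree p"
  using assms
proof (induction "degree p" arbitrary: p)
  case 0
  then show ?case
    using size_proots_le[of p] by simp
next
  case (Suc d)
  have deg: "degree (map_poly complex_of_real p) = Suc d"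
    using Suc.hyps(2) by (simp add: degree_map_poly)
  then obtain z where z: "poly (map_poly complex_of_real p) z = 0"
    using fundamental_theorem_of_algebra[of "map_poly complex_of_real p"]
    by (auto simp: constant_degree)
  with Suc.prems(2) have "z = of_real (Re z)" by (simp add: complex_eq_iff)
  then have "poly (map_poly of_real p) (complex_of_real (Re z)) = 0"
    using z by metis
  then have "poly p (Re z) = 0"
    by (simp add: poly_of_real_conv)
  then obtain q where q: "p = [:- Re z, 1:] * q"
    by (metis dvd_def poly_eq_0_iff_dvd)
  with Suc.prems have q0: "q \<noteq> 0" by auto
  have mp: "map_poly complex_of_real p = map_poly of_real [:- Re z, 1:] * map_poly of_real q"
    unfolding q by (rule map_poly_of_real_mult)
  have "degree p = degree [:- Re z, 1:] + degree q"
    unfolding q using q0 by (intro degree_mult_eq) auto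
  then have "degree q = d"
    using Suc.hyps(2) by simp
  then have "size (proots q) = degree q"
    using Suc.hyps(1)[of q] q0 Suc.prems(2) mp by auto
  then show ?case
    using q0 by (simp add: q proots_mult degree_mult_eq del: mult_pCons_left)
qed

section \<open>The zero set, factorisation and equilibrium of the zeros\<close>

definition hermite_zeros :: "nat \<Rightarrow> real set" where
  "hermite_zeros n = {x. poly (hermite n) x = 0}"

lemma finite_hermite_zeros [simp]: "finite (hermite_zeros n)"
  unfolding hermite_zeros_def by (rule poly_roots_finite) simp

lemma proots_hermite: "proots (hermite n) = mset_set (hermite_zeros n)"
proof (rule multiset_eqI)
  fix a
  show "count (proots (hermite n)) a = count (mset_set (hermite_zeros n)) a"
    using rsquarefree_root_order[OF rsquarefree_hermite, of n a]
    by (cases "a \<in> hermite_zeros n")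
       (auto simp: count_mset_set order_0I, auto simp: hermite_zeros_def order_0I)
qed

lemma card_hermite_zeros: "card (hermite_zeros n) = n"
  using size_proots_real_rooted[of "hermite n"] hermite_complex_zero_real[of n] degree_hermite_monic[of n]
  by (simp add: proots_hermite)

text \<open>Both sides are monic of degree \<open>n\<close> and agree at \<open>n\<close> distinct
  points.\<close>

lemma hermite_eq_prod: "hermite n = (\<Prod>a\<in>hermite_zeros n. [:- a, 1:])"
proof (rule poly_eqI_degree_lead_coeff[where A = "hermite_zeros n"])
  have d: "degree (\<Prod>a\<in>hermite_zeros n. [:- a, 1:]) = n"
    by (subst degree_prod_sum_eq) (auto simp: card_hermite_zeros)
  moreover have "lead_coeff (\<Prod>a\<in>hermite_zeros n. [:- a, 1:]) = 1"
    by (simp only: lead_coeff_prod) simp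
  ultimately show "coeff (hermite n) n = coeff (\<Prod>a\<in>hermite_zeros n. [:- a, 1:]) n"
    using degree_hermite_monic[of n] by simp
  show "degree (\<Prod>a\<in>hermite_zeros n. [:- a, 1:]) \<le> n" using d by simp
  show "poly (hermite n) z = poly (\<Prod>a\<in>hermite_zeros n. [:- a, 1:]) z" if "z \<in> hermite_zeros n" for z
  proof -
    have "(\<Prod>a\<in>hermite_zeros n. z - a) = 0"
      using that by (intro prod_zero) auto
    moreover have "poly (hermite n) z = 0"
      using that by (simp add: hermite_zeros_def)
    ultimately show ?thesis by (simp add: poly_prod)
  qed
qed (use degree_hermite_monic[of n] card_hermite_zeros in auto)

text \<open>Writing P = (X - a) Q gives P'(a) = Q(a) and P''(a) = 2 Q'(a), so the sum is the
  logarithmic derivative Q'(a) / Q(a).\<close>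

lemma pderiv_pderiv_prod_linear:
  fixes S :: "'a :: field_char_0 set"
  assumes S: "finite S" "a \<in> S"
  defines "P \<equiv> \<Prod>b\<in>S. [:- b, 1:]"
  shows "poly (pderiv P) a \<noteq> 0"
    and "poly (pderiv (pderiv P)) a = 2 * poly (pderiv P) a * (\<Sum>b\<in>S - {a}. 1 / (a - b))"
proof -
  define Q where "Q = (\<Prod>b\<in>S - {a}. [:- b, 1:])"
  have P: "P = [:- a, 1:] * Q"
    unfolding P_def Q_def using S by (rule prod.remove)
  have d1: "poly (pderiv P) a = poly Q a"
    unfolding P pderiv_mult by (simp add: pderiv_pCons)
  have d2: "poly (pderiv (pderiv P)) a = 2 * poly (pderiv Q) a"
    unfolding P pderiv_mult pderiv_add by (simp add: pderiv_pCons)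
  show "poly (pderiv P) a \<noteq> 0"
    unfolding d1 Q_def using S by (auto simp: poly_prod)
  have "poly (pderiv Q) a = (\<Sum>b\<in>S - {a}. (\<Prod>c\<in>S - {a} - {b}. a - c))"
    unfolding Q_def pderiv_prod by (simp add: poly_sum poly_prod pderiv_pCons)
  also have "\<dots> = (\<Sum>b\<in>S - {a}. poly Q a * (1 / (a - b)))"
  proof (rule sum.cong)
    fix b assume b: "b \<in> S - {a}"
    then have "poly Q a = (a - b) * (\<Prod>c\<in>S - {a} - {b}. a - c)"
      using S b prod.remove[of "S - {a}" b "\<lambda>c. a - c"] by (simp add: Q_def poly_prod)
    then show "(\<Prod>c\<in>S - {a} - {b}. a - c) = poly Q a * (1 / (a - b))"
      using b by (simp add: eq_commute[of a b])
  qed simp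
  finally show "poly (pderiv (pderiv P)) a = 2 * poly (pderiv P) a * (\<Sum>b\<in>S - {a}. 1 / (a - b))"
    unfolding d1 d2 by (simp add: sum_distrib_left)
qed

text \<open>Compare the two expressions for H''(a), from the differential equation and from the
  factorisation, and cancel the nonzero H'(a).\<close>

lemma hermite_zeros_stieltjes:
  assumes "a \<in> hermite_zeros n"
  shows "(\<Sum>b\<in>hermite_zeros n - {a}. 1 / (a - b)) = a / 2"
  using pderiv_pderiv_prod_linear[OF finite_hermite_zeros assms] hermite_ode_at_zero[of n a] assms
  by (simp add: hermite_eq_prod[symmetric]) (simp add: hermite_zeros_def)

text \<open>Put s = sqrt n. If |x| is at least 2 s and the ratio of consecutive absolute values is
  at least s, the recurrence makes the next ratio at least 2 s - n / s = s. So no zero lies that far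
  out.\<close>

lemma hermite_growth:
  assumes "2 * sqrt (real n) \<le> \<bar>x\<bar>" "k < n"
  shows "poly (hermite k) x \<noteq> 0
    \<and> sqrt (real n) * \<bar>poly (hermite k) x\<bar> \<le> \<bar>poly (hermite (Suc k)) x\<bar>"
  using assms(2)
proof (induction k)
  case 0
  have "sqrt (real n) \<ge> 0" by simp
  then show ?case using assms(1) by (auto simp: hermite_0 hermite_1)
next
  case (Suc k)
  let ?h = "\<lambda>k. \<bar>poly (hermite k) x\<bar>" and ?s = "sqrt (real n)"
  have IH: "poly (hermite k) x \<noteq> 0" "?s * ?h k \<le> ?h (Suc k)" and s: "?s > 0"
    using Suc by auto
  have "?h (Suc (Suc k)) \<ge> \<bar>x\<bar> * ?h (Suc k) - real (Suc k) * ?h k"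
    unfolding poly_hermite_Suc_Suc
    by (metis abs_mult abs_of_nat abs_triangle_ineq2)
  moreover have "real (Suc k) * ?h k \<le> real n * ?h k"
    using Suc.prems by (intro mult_right_mono) auto
  moreover have "real n * ?h k = ?s * (?s * ?h k)"
    by simp
  moreover have "?s * (?s * ?h k) \<le> ?s * ?h (Suc k)"
    using IH s by (intro mult_left_mono) auto
  moreover have "2 * (?s * ?h (Suc k)) \<le> \<bar>x\<bar> * ?h (Suc k)"
    using mult_right_mono[OF assms(1), of "?h (Suc k)"] by simp
  ultimately have "?s * ?h (Suc k) \<le> ?h (Suc (Suc k))"
    by linarith
  moreover have "0 < ?s * ?h k"
    using IH s by simp
  ultimately show ?case
    using IH(2) by fastforce
qed

lemma hermite_zeros_bound:
  assumes "n \<ge> 1" "x \<in> hermite_zeros n"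
  shows "\<bar>x\<bar> \<le> 2 * sqrt (real n)"
proof (rule ccontr)
  assume "\<not> ?thesis"
  then have "2 * sqrt (real n) \<le> \<bar>x\<bar>" by simp
  from hermite_growth[OF this, of "n - 1"] assms show False
    by (auto simp: hermite_zeros_def mult_le_0_iff)
qed

section \<open>Chebyshev polynomials of the second kind\<close>

fun cheb_U :: "nat \<Rightarrow> real \<Rightarrow> real" where
  "cheb_U 0 x = 1"
| "cheb_U (Suc 0) x = 2 * x"
| "cheb_U (Suc (Suc k)) x = 2 * x * cheb_U (Suc k) x - cheb_U k x"

lemma continuous_on_cheb_U [continuous_intros]:
  "continuous_on S f \<Longrightarrow> continuous_on S (\<lambda>x. cheb_U k (f x))"
  by (induction k rule: induct_nat_012) (auto intro!: continuous_intros)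

text \<open>The usual trigonometric description, kept free of division so that it also holds where
  \<open>sin t\<close> vanishes.\<close>

lemma cheb_U_cos: "cheb_U k (cos t) * sin t = sin (real (Suc k) * t)"
proof (induction k rule: induct_nat_012)
  case 1
  show ?case by (simp add: sin_double)
next
  case (ge2 n)
  have "cheb_U (Suc (Suc n)) (cos t) * sin t
      = 2 * cos t * (cheb_U (Suc n) (cos t) * sin t) - cheb_U n (cos t) * sin t"
    by (simp add: algebra_simps)
  also have "\<dots> = 2 * cos t * sin (real (Suc (Suc n)) * t) - sin (real (Suc n) * t)"
    unfolding ge2 ..
  also have "\<dots> = sin (real (Suc (Suc (Suc n))) * t)"
  proof -
    have "real (Suc (Suc (Suc n))) * t = real (Suc (Suc n)) * t + t"
      "real (Suc n) * t = real (Suc (Suc n)) * t - t"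
      by (simp_all add: algebra_simps)
    then show ?thesis by (simp only: sin_add sin_diff) simp
  qed
  finally show ?case .
qed simp

text \<open>Both sides satisfy the same inhomogeneous three-term recurrence in \<open>k\<close>. The
  products on the right become products of averages after summation over \<open>x\<close> and
  \<open>y\<close>.\<close>

lemma cheb_U_diff_quotient:
  "cheb_U (Suc k) x - cheb_U (Suc k) y = 2 * (x - y) * (\<Sum>l\<le>k. cheb_U l x * cheb_U (k - l) y)"
proof (induction k rule: induct_nat_012)
  case (ge2 n)
  let ?E = "\<lambda>k. \<Sum>l\<le>k. cheb_U l x * cheb_U (k - l) y"
  \<comment> \<open>The terms l = 0 and l = 1 are split off, so that the recurrence applies to the
    factor in \<open>x\<close> of every remaining term.\<close>
  have "?E (Suc (Suc n)) = cheb_U (Suc (Suc n)) y + (2 * x * cheb_U (Suc n) y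
      + (\<Sum>l\<le>n. (2 * x * cheb_U (Suc l) x - cheb_U l x) * cheb_U (n - l) y))"
    by (simp only: sum.atMost_Suc_shift) simp
  also have "(\<Sum>l\<le>n. (2 * x * cheb_U (Suc l) x - cheb_U l x) * cheb_U (n - l) y) =
      2 * x * (\<Sum>l\<le>n. cheb_U (Suc l) x * cheb_U (n - l) y) - ?E n"
    by (simp add: left_diff_distrib sum_subtractf sum_distrib_left mult.assoc)
  also have "cheb_U (Suc (Suc n)) y + (2 * x * cheb_U (Suc n) y + \<dots>)
      = cheb_U (Suc (Suc n)) y + 2 * x * ?E (Suc n) - ?E n"
    by (simp only: sum.atMost_Suc_shift) (simp add: algebra_simps)
  finally have E: "?E (Suc (Suc n)) = cheb_U (Suc (Suc n)) y + 2 * x * ?E (Suc n) - ?E n" .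
  have "cheb_U (Suc (Suc (Suc n))) x - cheb_U (Suc (Suc (Suc n))) y =
      2 * x * (cheb_U (Suc (Suc n)) x - cheb_U (Suc (Suc n)) y)
      + 2 * (x - y) * cheb_U (Suc (Suc n)) y - (cheb_U (Suc n) x - cheb_U (Suc n) y)"
    by (simp add: algebra_simps)
  also have "\<dots> = 2 * (x - y) * ?E (Suc (Suc n))"
    unfolding E ge2 by (simp add: algebra_simps)
  finally show ?case .
qed (simp_all add: algebra_simps)

section \<open>Integration against the semicircle density\<close>

text \<open>A gauge integral over the compact support, so that the fundamental theorem of calculus
  applies directly.\<close>

definition semicircle_integral :: "(real \<Rightarrow> real) \<Rightarrow> real" where
  "semicircle_integral f = integral {-1..1} (\<lambda>x. 2 / pi * sqrt (1 - x\<^sup>2) * f x)"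

lemma integral_semicircle:
  fixes f :: "real \<Rightarrow> real"
  assumes f: "continuous_on UNIV f"
  shows "integral\<^sup>L semicircle f = semicircle_integral f"
proof -
  have [measurable]: "f \<in> borel_measurable borel"
    using f by (rule borel_measurable_continuous_onI)
  have meas [measurable]: "semicircle_density \<in> borel_measurable borel"
    unfolding semicircle_density_def[abs_def] by measurable
  have nn: "semicircle_density x \<ge> 0" for x
    by (auto simp: semicircle_density_def indicator_def abs_square_le_1 abs_le_iff)
  have cont: "continuous_on {-1..1} (\<lambda>x. 2 / pi * sqrt (1 - x\<^sup>2) * f x)"
    using continuous_on_subset[OF f] by (auto intro!: continuous_intros)
  have "integral\<^sup>L semicircle f = (\<integral>x. semicircle_density x * f x \<partial>lborel)"
    unfolding semicircle_def by (intro integral_real_density) (auto simp: nn)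
  also have "\<dots> = (LINT x:{-1..1}|lborel. 2 / pi * sqrt (1 - x\<^sup>2) * f x)"
    unfolding set_lebesgue_integral_def semicircle_density_def
    by (intro Bochner_Integration.integral_cong) auto
  also have "\<dots> = semicircle_integral f"
    unfolding semicircle_integral_def
    by (intro set_borel_integral_eq_integral borel_integrable_atLeastAtMost')
       (rule cont)
  finally show ?thesis .
qed

lemma semicircle_density_integrable:
  assumes "continuous_on {-1..1} f"
  shows "(\<lambda>x. 2 / pi * sqrt (1 - x\<^sup>2) * f x) integrable_on {-1..1}"
  using assms by (intro integrable_continuous_real continuous_intros)

lemma semicircle_integral_const: "semicircle_integral (\<lambda>x. c) = c"
proof -
  interpret real_distribution semicircle by (rule real_distribution_semicircle)
  have "prob UNIV = 1" using prob_space by (simp add: semicircle_def)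
  then show ?thesis using integral_semicircle[of "\<lambda>x. c"] by simp
qed

text \<open>Orthogonality of \<open>cheb_U k\<close> to \<open>cheb_U 0\<close> under the semicircle
  weight, shown by an explicit antiderivative.\<close>

lemma semicircle_integral_cheb_U:
  assumes "k \<ge> 1"
  shows "semicircle_integral (cheb_U k) = 0"
proof -
  \<comment> \<open>With x = cos t, the identity 2 sin t sin((k+1)t) = cos(kt) - cos((k+2)t) leads
    to this antiderivative; \<open>k \<ge> 1\<close> keeps the second denominator nonzero.\<close>
  define G where "G x = (sin ((real k + 2) * arccos x) / (real k + 2) - sin (real k * arccos x) / real k) / pi" for x
  have der: "(G has_vector_derivative 2 / pi * sqrt (1 - x\<^sup>2) * cheb_U k x) (at x)"
    if x: "x \<in> {-1<..<1}" for x
  proof -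
    define t where "t = arccos x"
    have t: "cos t = x" "sin t = sqrt (1 - x\<^sup>2)"
      using x by (auto simp: t_def sin_arccos)
    have "x\<^sup>2 < 1" using x by (simp add: abs_square_less_1 abs_less_iff)
    then have st: "sin t > 0" by (simp add: t)
    have "((\<lambda>x. sin (c * arccos x) / c) has_real_derivative cos (c * t) * inverse (- sin t)) (at x)"
      if "c \<noteq> 0" for c
      unfolding t(2) unfolding t_def using x that by (auto intro!: derivative_eq_intros)
    from DERIV_cdivide[OF DERIV_diff[OF this[of "real k + 2"] this[of "real k"]], of pi]
    have "(G has_real_derivative
        (cos ((real k + 2) * t) - cos (real k * t)) * inverse (- sin t) / pi) (at x)"
      using assms unfolding G_def left_diff_distrib by simp
    moreover have "cos ((real k + 2) * t) - cos (real k * t) = - 2 * sin (real (Suc k) * t) * sin t"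
    proof -
      have "(real k + 2) * t = real (Suc k) * t + t" "real k * t = real (Suc k) * t - t"
        by (simp_all add: algebra_simps)
      then show ?thesis by (simp only: cos_add cos_diff)
    qed
    moreover have "- 2 * (sin (real (Suc k) * t)) * sin t * inverse (- sin t) / pi
        = 2 / pi * sin t * cheb_U k x"
      using st unfolding cheb_U_cos[symmetric] t(1) by (simp add: field_simps)
    ultimately show ?thesis
      by (simp only: has_real_derivative_iff_has_vector_derivative t(2))
  qed
  have cont: "continuous_on {-1..1} G"
    unfolding G_def using assms by (intro continuous_intros continuous_on_arccos) auto
  \<comment> \<open>Since \<open>arccos\<close> takes the values \<open>pi\<close> and 0 at the
    endpoints, \<open>G\<close> vanishes at both.\<close>
  have "sin ((real k + 2) * pi) = 0" "sin (real k * pi) = 0"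
    using sin_npi[of "k + 2"] by (simp_all add: add.commute)
  then have "((\<lambda>x. 2 / pi * sqrt (1 - x\<^sup>2) * cheb_U k x) has_integral 0) {-1..1}"
    using fundamental_theorem_of_calculus_interior[OF _ cont der] by (simp add: G_def)
  then show ?thesis
    unfolding semicircle_integral_def by (rule integral_unique)
qed

section \<open>The limit of the averages\<close>

text \<open>These properties of the normalized zeros suffice for the limit; Hermite polynomials do
  not occur in the argument below.\<close>

locale scaled_equilibrium =
  fixes T :: "nat \<Rightarrow> real set"
  assumes finite_T [simp]: "\<And>n. finite (T n)"
    and card_T: "\<And>n. card (T n) = n"
    and T_bound: "\<And>n x. n \<ge> 1 \<Longrightarrow> x \<in> T n \<Longrightarrow> x \<in> {-1..1}"
    and stieltjes: "\<And>n a. a \<in> T n \<Longrightarrow> (\<Sum>b\<in>T n - {a}. 1 / (a - b)) = 2 * real n * a"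
begin

definition average :: "nat \<Rightarrow> (real \<Rightarrow> real) \<Rightarrow> real" where
  "average n f = (\<Sum>a\<in>T n. f a) / real n"

lemma average_add: "average n (\<lambda>x. f x + g x) = average n f + average n g"
  and average_diff: "average n (\<lambda>x. f x - g x) = average n f - average n g"
  and average_cmult: "average n (\<lambda>x. c * f x) = c * average n f"
  by (simp_all add: average_def sum.distrib sum_subtractf sum_distrib_left add_divide_distrib diff_divide_distrib)

lemma average_abs_le:
  assumes "n \<ge> 1" "\<And>x. x \<in> {-1..1} \<Longrightarrow> \<bar>f x\<bar> \<le> B"
  shows "\<bar>average n f\<bar> \<le> B"
proof -
  have "\<bar>\<Sum>a\<in>T n. f a\<bar> \<le> (\<Sum>a\<in>T n. B)"
    using assms T_bound by (intro order_trans[OF sum_abs] sum_mono) blast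
  then show ?thesis
    using assms(1) by (simp add: average_def card_T divide_le_eq mult.commute)
qed

text \<open>The pairs (a, b) and (b, a) together contribute (f a - f b) / (a - b). The assumption
  leaves \<open>D\<close> arbitrary on the diagonal, which is harmless because the diagonal terms on
  the right cancel.\<close>

lemma loop_equation:
  assumes "\<And>x y. f x - f y = (x - y) * D x y"
  shows "4 * real n * (\<Sum>a\<in>T n. a * f a) = (\<Sum>a\<in>T n. \<Sum>b\<in>T n. D a b) - (\<Sum>a\<in>T n. D a a)"
proof -
  \<comment> \<open>The value 0 on the diagonal lets both sums run over all of \<open>T n\<close>,
    so that they can be swapped.\<close>
  define F where "F a b = (if a = b then 0 else f a / (a - b))" for a b
  have "2 * real n * (\<Sum>a\<in>T n. a * f a) = (\<Sum>a\<in>T n. f a * (\<Sum>b\<in>T n - {a}. 1 / (a - b)))"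
    by (simp add: stieltjes sum_distrib_left mult_ac)
  also have "\<dots> = (\<Sum>a\<in>T n. \<Sum>b\<in>T n. F a b)"
  proof (rule sum.cong)
    fix a assume a: "a \<in> T n"
    have "f a * (\<Sum>b\<in>T n - {a}. 1 / (a - b)) = (\<Sum>b\<in>T n - {a}. F a b)"
      by (auto simp: sum_distrib_left F_def intro!: sum.cong)
    also have "\<dots> = (\<Sum>b\<in>T n. F a b)"
      by (rule sum.mono_neutral_left) (auto simp: F_def)
    finally show "f a * (\<Sum>b\<in>T n - {a}. 1 / (a - b)) = (\<Sum>b\<in>T n. F a b)" .
  qed simp
  finally have s1: "2 * real n * (\<Sum>a\<in>T n. a * f a) = (\<Sum>a\<in>T n. \<Sum>b\<in>T n. F a b)" .
  then have s2: "2 * real n * (\<Sum>a\<in>T n. a * f a) = (\<Sum>a\<in>T n. \<Sum>b\<in>T n. F b a)"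
    by (subst sum.swap)
  have sym: "F a b + F b a = D a b - (if a = b then D a a else 0)" for a b
  proof (cases "a = b")
    case False
    then have "F a b + F b a = (f a - f b) / (a - b)"
      by (simp add: F_def divide_simps) (simp add: algebra_simps)
    then show ?thesis using False by (simp add: assms)
  qed (simp add: F_def)
  have "4 * real n * (\<Sum>a\<in>T n. a * f a) = (\<Sum>a\<in>T n. \<Sum>b\<in>T n. F a b + F b a)"
    using s1 s2 by (simp add: sum.distrib)
  also have "\<dots> = (\<Sum>a\<in>T n. \<Sum>b\<in>T n. D a b) - (\<Sum>a\<in>T n. D a a)"
    by (simp add: sym sum_subtractf)
  finally show ?thesis .
qed

text \<open>The loop equation for \<open>cheb_U (Suc k)\<close>: on the left 2 x U_{k+1} = U_{k+2} +
  U_k, on the right the double sum factorises, and the diagonal gives the term of order 1 /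
  n.\<close>

lemma average_cheb_U_rec:
  assumes "n \<ge> 1"
  shows "average n (cheb_U (Suc (Suc k))) =
    (\<Sum>l\<le>k. average n (cheb_U l) * average n (cheb_U (k - l))) - average n (cheb_U k)
    - average n (\<lambda>x. \<Sum>l\<le>k. cheb_U l x * cheb_U (k - l) x) / real n"
proof -
  let ?M = "\<lambda>k. \<Sum>a\<in>T n. cheb_U k a"
  let ?D = "\<lambda>x y. \<Sum>l\<le>k. cheb_U l x * cheb_U (k - l) y"
  have "4 * real n * (\<Sum>a\<in>T n. a * cheb_U (Suc k) a) =
      (\<Sum>a\<in>T n. \<Sum>b\<in>T n. 2 * ?D a b) - (\<Sum>a\<in>T n. 2 * ?D a a)"
    by (rule loop_equation) (simp add: cheb_U_diff_quotient)
  also have "(\<Sum>a\<in>T n. \<Sum>b\<in>T n. 2 * ?D a b) = 2 * (\<Sum>l\<le>k. ?M l * ?M (k - l))"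
    unfolding sum_product sum_distrib_left
    by (simp only: sum.swap[of _ "{..k}"] sum_distrib_left[symmetric] sum_distrib_right[symmetric])
  also have "4 * real n * (\<Sum>a\<in>T n. a * cheb_U (Suc k) a) = 2 * real n * (?M (Suc (Suc k)) + ?M k)"
    by (simp add: sum_subtractf sum_distrib_left mult_ac)
  finally have *: "real n * (?M (Suc (Suc k)) + ?M k) = (\<Sum>l\<le>k. ?M l * ?M (k - l)) - (\<Sum>a\<in>T n. ?D a a)"
    by (simp flip: sum_distrib_left)
  have "(?M (Suc (Suc k)) + ?M k) / real n =
      ((\<Sum>l\<le>k. ?M l * ?M (k - l)) - (\<Sum>a\<in>T n. ?D a a)) / (real n * real n)"
    unfolding *[symmetric] using assms by (simp del: cheb_U.simps)
  then show ?thesis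
    unfolding average_def by (simp add: add_divide_distrib diff_divide_distrib sum_divide_distrib[of _ "{..k}"] del: cheb_U.simps)
qed

lemma average_cheb_U_0: "n \<ge> 1 \<Longrightarrow> average n (cheb_U 0) = 1"
  by (simp add: average_def card_T)

lemma average_cheb_U_1: "average n (cheb_U (Suc 0)) = 0"
proof -
  have "4 * real n * (\<Sum>a\<in>T n. a * 1) = 0"
    \<comment> \<open>A constant function has difference quotient 0, so the points sum to 0.\<close>
    using loop_equation[of "\<lambda>_. 1" "\<lambda>_ _. 0"] by simp
  then show ?thesis by (auto simp: average_def simp flip: sum_distrib_left)
qed

lemma average_remainder_tendsto_0:
  assumes "continuous_on {-1..1} f"
  shows "(\<lambda>n. average n f / real n) \<longlonglongrightarrow> 0"
proof -
  have "bounded (f ` {-1..1})"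
    using assms by (intro compact_imp_bounded compact_continuous_image) auto
  then obtain B where B: "\<And>x. x \<in> {-1..1} \<Longrightarrow> \<bar>f x\<bar> \<le> B"
    unfolding bounded_iff by (metis image_eqI real_norm_def)
  show ?thesis
  proof (rule Lim_null_comparison)
    show "\<forall>\<^sub>F n in sequentially. norm (average n f / real n) \<le> B / real n"
      using average_abs_le[of _ f, OF _ B]
      by (intro eventually_sequentiallyI[of 1]) (simp add: divide_right_mono)
  qed real_asymp
qed

lemma average_cheb_U_tendsto: "(\<lambda>n. average n (cheb_U k)) \<longlonglongrightarrow> (if k = 0 then 1 else 0)"
proof (induction k rule: less_induct)
  case (less k)
  consider "k = 0" | "k = Suc 0" | m where "k = Suc (Suc m)"
    by (metis not0_implies_Suc)
  then show ?case
  proof cases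
    case 1
    then show ?thesis
      using average_cheb_U_0 by (auto intro!: tendsto_eventually eventually_sequentiallyI[of 1] simp del: cheb_U.simps)
  next
    case 2
    then show ?thesis by (simp add: average_cheb_U_1 del: cheb_U.simps)
  next
    case (3 m)
    let ?c = "\<lambda>k. if k = (0::nat) then 1 else 0 :: real"
    have "(\<lambda>n. (\<Sum>l\<le>m. average n (cheb_U l) * average n (cheb_U (m - l))) - average n (cheb_U m)
        - average n (\<lambda>x. \<Sum>l\<le>m. cheb_U l x * cheb_U (m - l) x) / real n)
      \<longlonglongrightarrow> (\<Sum>l\<le>m. ?c l * ?c (m - l)) - ?c m - 0"
      using 3 by (intro tendsto_intros less.IH average_remainder_tendsto_0 continuous_intros) auto
    \<comment> \<open>A product of limits survives only for l = 0 and m = 0, so the sum is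
      \<open>?c m\<close> and cancels against the subtracted \<open>?c m\<close>.\<close>
    also have "(\<Sum>l\<le>m. ?c l * ?c (m - l)) = (\<Sum>l\<le>m. if l = 0 then ?c m else 0)"
      by (rule sum.cong) auto
    also have "\<dots> - ?c m - 0 = ?c k"
      using 3 by simp
    finally show ?thesis
      by (rule Lim_transform_eventually)
         (use average_cheb_U_rec 3 in \<open>auto intro!: eventually_sequentiallyI[of 1] simp del: cheb_U.simps\<close>)
  qed
qed

text \<open>The factor \<open>cheb_U k\<close> makes induction on \<open>m\<close> possible: x U_k =
  (U_{k+1} + U_{k-1}) / 2 trades one power of x for a change of index. The case k = 0 gives the
  moments.\<close>

lemma average_power_cheb_U_tendsto:
  "(\<lambda>n. average n (\<lambda>x. x ^ m * cheb_U k x)) \<longlonglongrightarrow> semicircle_integral (\<lambda>x. x ^ m * cheb_U k x)"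
proof (induction m arbitrary: k)
  case 0
  show ?case
    using average_cheb_U_tendsto[of k] semicircle_integral_cheb_U[of k] semicircle_integral_const[of 1]
    by (cases "k = 0") (auto simp del: cheb_U.simps simp: cheb_U.simps(1)[abs_def])
next
  case (Suc m)
  have integ: "(\<lambda>x. 2 / pi * sqrt (1 - x\<^sup>2) * (x ^ m * cheb_U k x)) integrable_on {-1..1}" for k
    by (intro semicircle_density_integrable continuous_intros)
  show ?case
  proof (cases k)
    case 0
    have *: "(\<lambda>x. x ^ Suc m * cheb_U k x) = (\<lambda>x. 1 / 2 * (x ^ m * cheb_U (Suc 0) x))"
      by (simp add: 0 mult.commute)
    have "semicircle_integral (\<lambda>x. 1 / 2 * (x ^ m * cheb_U (Suc 0) x))
        = 1 / 2 * semicircle_integral (\<lambda>x. x ^ m * cheb_U (Suc 0) x)"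
      unfolding semicircle_integral_def integral_mult_right[symmetric] by (simp only: mult_ac)
    then show ?thesis
      unfolding * average_cmult by (simp only:) (intro tendsto_intros Suc.IH)
  next
    case (Suc j)
    have *: "(\<lambda>x. x ^ Suc m * cheb_U k x)
        = (\<lambda>x. 1 / 2 * (x ^ m * cheb_U (Suc (Suc j)) x + x ^ m * cheb_U j x))"
      by (simp add: Suc algebra_simps)
    have "semicircle_integral (\<lambda>x. 1 / 2 * (x ^ m * cheb_U (Suc (Suc j)) x + x ^ m * cheb_U j x))
        = 1 / 2 * (semicircle_integral (\<lambda>x. x ^ m * cheb_U (Suc (Suc j)) x)
          + semicircle_integral (\<lambda>x. x ^ m * cheb_U j x))"
      unfolding semicircle_integral_def integral_add[OF integ integ, symmetric]
        integral_mult_right[symmetric]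
      by (intro integral_cong) (simp add: algebra_simps del: cheb_U.simps)
    then show ?thesis
      unfolding * average_cmult average_add by (simp only:) (intro tendsto_intros Suc.IH)
  qed
qed

lemma average_polynomial_tendsto:
  assumes "real_polynomial_function p"
  shows "(\<lambda>n. average n p) \<longlonglongrightarrow> semicircle_integral p"
proof -
  obtain c N where p: "p = (\<lambda>x. \<Sum>i\<le>N. c i * x ^ i)"
    using assms by (auto simp: real_polynomial_function_iff_sum)
  have av: "average n p = (\<Sum>i\<le>N. c i * average n (\<lambda>x. x ^ i * cheb_U 0 x))" for n
    unfolding p average_def
    by (subst sum.swap) (simp add: sum_distrib_left sum_divide_distrib)
  have "semicircle_integral p
      = integral {-1..1} (\<lambda>x. \<Sum>i\<le>N. 2 / pi * sqrt (1 - x\<^sup>2) * (c i * (x ^ i * cheb_U 0 x)))"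
    unfolding p semicircle_integral_def by (simp add: sum_distrib_left)
  also have "\<dots> = (\<Sum>i\<le>N. integral {-1..1} (\<lambda>x. 2 / pi * sqrt (1 - x\<^sup>2) * (c i * (x ^ i * cheb_U 0 x))))"
    by (intro integral_sum semicircle_density_integrable continuous_intros) auto
  also have "\<dots> = (\<Sum>i\<le>N. c i * semicircle_integral (\<lambda>x. x ^ i * cheb_U 0 x))"
    unfolding semicircle_integral_def integral_mult_right[symmetric] by (simp only: mult_ac)
  finally show ?thesis
    unfolding av by (auto intro!: tendsto_intros average_power_cheb_U_tendsto simp del: cheb_U.simps)
qed

theorem average_tendsto:
  assumes f: "continuous_on {-1..1} f"
  shows "(\<lambda>n. average n f) \<longlonglongrightarrow> semicircle_integral f"
proof (rule LIMSEQ_I)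
  fix e :: real assume e: "e > 0"
  then obtain p where p: "real_polynomial_function p" "\<And>x. x \<in> {-1..1} \<Longrightarrow> \<bar>f x - p x\<bar> < e / 3"
    using Stone_Weierstrass_real_polynomial_function[of "{-1..1}" f "e / 3"] f by auto
  have cp: "continuous_on {-1..1} p"
    using p(1) continuous_on_polymonial_function real_polynomial_function_eq by blast
  \<comment> \<open>The weight is nonnegative with total mass 1, so replacing \<open>f\<close> by
    \<open>p\<close> costs at most e / 3 here, just as it does for the averages.\<close>
  have "\<bar>semicircle_integral f - semicircle_integral p\<bar> \<le> semicircle_integral (\<lambda>_. e / 3)"
  proof -
    have d: "semicircle_integral f - semicircle_integral p
        = integral {-1..1} (\<lambda>x. 2 / pi * sqrt (1 - x\<^sup>2) * (f x - p x))"
      unfolding semicircle_integral_def right_diff_distrib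
      by (intro integral_diff[symmetric] semicircle_density_integrable f cp)
    have "norm (2 / pi * sqrt (1 - x\<^sup>2) * (f x - p x)) \<le> 2 / pi * sqrt (1 - x\<^sup>2) * (e / 3)"
      if x: "x \<in> {-1..1}" for x
    proof -
      have "0 \<le> 2 / pi * sqrt (1 - x\<^sup>2)"
        using x by (simp add: abs_square_le_1 abs_le_iff)
      moreover have "\<bar>f x - p x\<bar> \<le> e / 3" using p(2)[OF x] by simp
      ultimately show ?thesis
        unfolding real_norm_def abs_mult[of _ "f x - p x"] by (simp only: abs_of_nonneg mult_left_mono)
    qed
    then have "norm (integral {-1..1} (\<lambda>x. 2 / pi * sqrt (1 - x\<^sup>2) * (f x - p x)))
        \<le> semicircle_integral (\<lambda>_. e / 3)"
      unfolding semicircle_integral_def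
      by (intro integral_norm_bound_integral semicircle_density_integrable continuous_intros f cp)
    then show ?thesis unfolding d by simp
  qed
  then have I: "\<bar>semicircle_integral f - semicircle_integral p\<bar> \<le> e / 3"
    by (simp only: semicircle_integral_const)
  obtain N where N: "\<And>n. n \<ge> N \<Longrightarrow> \<bar>average n p - semicircle_integral p\<bar> < e / 3"
    using LIMSEQ_D[OF average_polynomial_tendsto[OF p(1)], of "e / 3"] e by auto
  have "norm (average n f - semicircle_integral f) < e" if n: "n \<ge> max 1 N" for n
  proof -
    have "\<bar>average n (\<lambda>x. f x - p x)\<bar> \<le> e / 3"
      using n p(2) by (intro average_abs_le) (auto intro: less_imp_le)
    moreover have "average n f - semicircle_integral f = average n (\<lambda>x. f x - p x)
        + (average n p - semicircle_integral p) - (semicircle_integral f - semicircle_integral p)"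
      by (simp add: average_diff)
    ultimately show ?thesis
      using N[of n] n I unfolding real_norm_def by linarith
  qed
  then show "\<exists>N. \<forall>n\<ge>N. norm (average n f - semicircle_integral f) < e" by blast
qed

end

section \<open>The normalized Hermite zeros and their empirical measures\<close>

interpretation hermite: scaled_equilibrium "\<lambda>n. (\<lambda>x. x / (2 * sqrt (real n))) ` hermite_zeros n"
proof
  fix n :: nat
  let ?s = "2 * sqrt (real n)"
  have inj: "inj_on (\<lambda>x. x / ?s) (hermite_zeros n)"
  \<comment> \<open>For n = 0 the scaling divides by 0, but there are no zeros to scale.\<close>
  proof (cases "n = 0")
    case True
    then show ?thesis by (simp add: hermite_zeros_def hermite_0)
  qed (auto simp: inj_on_def)
  show "card ((\<lambda>x. x / ?s) ` hermite_zeros n) = n"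
    using card_image[OF inj] by (simp add: card_hermite_zeros)
  show "x \<in> {-1..1}" if "n \<ge> 1" "x \<in> (\<lambda>x. x / ?s) ` hermite_zeros n" for x
    using that hermite_zeros_bound[of n] by (fastforce simp: abs_le_iff field_simps)
  \<comment> \<open>Scaling multiplies the sum x / 2 by \<open>?s\<close>; since x =
    \<open>?s * a\<close> and \<open>?s\<close> squared is 4 n, the result is 2 n a.\<close>
  show "(\<Sum>b\<in>(\<lambda>x. x / ?s) ` hermite_zeros n - {a}. 1 / (a - b)) = 2 * real n * a"
    if a: "a \<in> (\<lambda>x. x / ?s) ` hermite_zeros n" for a
  proof -
    from a obtain x where x: "x \<in> hermite_zeros n" "a = x / ?s" by auto
    then have n: "n > 0" using hermite_zeros_def hermite_0 by (cases n) auto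
    have "(\<lambda>x. x / ?s) ` hermite_zeros n - {a} = (\<lambda>x. x / ?s) ` (hermite_zeros n - {x})"
      using inj_on_image_set_diff[OF inj, of "hermite_zeros n" "{x}"] x by auto
    then have "(\<Sum>b\<in>(\<lambda>x. x / ?s) ` hermite_zeros n - {a}. 1 / (a - b))
        = (\<Sum>y\<in>hermite_zeros n - {x}. 1 / (a - y / ?s))"
      using inj_on_subset[OF inj] by (simp add: sum.reindex)
    also have "\<dots> = (\<Sum>y\<in>hermite_zeros n - {x}. ?s * (1 / (x - y)))"
      using n x by (intro sum.cong) (auto simp: diff_divide_distrib[symmetric])
    also have "\<dots> = ?s * (x / 2)"
      by (simp only: hermite_zeros_stieltjes[OF x(1)] sum_distrib_left[symmetric])
    also have "\<dots> = 2 * real n * a"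
    proof -
      have "x = ?s * a" using n x by simp
      then show ?thesis by simp
    qed
    finally show ?thesis .
  qed
qed simp

text \<open>As a push-forward of the uniform measure on the indices, integration reduces to a finite
  sum.\<close>

lemma empirical_measure_eq_distr:
  "empirical_measure n x = distr (point_measure {1..n} (\<lambda>_. ennreal (1 / real n))) borel x"
proof (rule measure_eqI)
  fix A assume "A \<in> sets (empirical_measure n x)"
  then have A: "A \<in> sets borel" by simp
  have "emeasure (distr (point_measure {1..n} (\<lambda>_. ennreal (1 / real n))) borel x) A
      = (\<Sum>j\<in>x -` A \<inter> {1..n}. ennreal (1 / real n))"
    using A by (subst emeasure_distr) (auto simp: space_point_measure emeasure_point_measure_finite)
  also have "\<dots> = (\<Sum>j=1..n. ennreal (1 / real n) * indicator A (x j))"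
    by (rule sum.mono_neutral_cong_left) (auto simp: indicator_def)
  also have "\<dots> = emeasure (empirical_measure n x) A"
    using A by (simp add: emeasure_empirical_measure sum_distrib_left)
  finally show "emeasure (empirical_measure n x) A
      = emeasure (distr (point_measure {1..n} (\<lambda>_. ennreal (1 / real n))) borel x) A" ..
qed simp

lemma integral_empirical_measure:
  fixes f :: "real \<Rightarrow> real"
  assumes [measurable]: "f \<in> borel_measurable borel"
  shows "integral\<^sup>L (empirical_measure n x) f = (\<Sum>j=1..n. f (x j)) / real n"
  unfolding empirical_measure_eq_distr
  by (subst integral_distr) (auto simp: lebesgue_integral_point_measure_finite sum_divide_distrib)

text \<open>Because the zeros are simple, the sorted list of the root multiset enumerates
  \<open>hermite_zeros n\<close> without repetition.\<close>

lemma sum_normalized_zero: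
  "(\<Sum>j=1..n. f (normalized_zero n j)) = (\<Sum>x\<in>hermite_zeros n. f (x / (2 * sqrt (real n))))"
proof -
  define xs where "xs = sorted_list_of_set (hermite_zeros n)"
  let ?g = "\<lambda>x. f (x / (2 * sqrt (real n)))"
  have len: "length xs = n" by (simp add: xs_def card_hermite_zeros)
  have "(\<Sum>j=1..n. f (normalized_zero n j)) = (\<Sum>j=1..n. ?g (xs ! (j - 1)))"
    by (simp add: normalized_zero_def hermite_zero_def proots_hermite
        sorted_list_of_mset_set xs_def)
  also have "\<dots> = (\<Sum>j<n. ?g (xs ! j))"
    by (rule sum.reindex_bij_witness[of _ Suc "\<lambda>j. j - 1"]) auto
  also have "\<dots> = sum_list (map ?g xs)"
    by (simp add: sum_list_sum_nth len atLeast0LessThan)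
  also have "\<dots> = (\<Sum>x\<in>hermite_zeros n. ?g x)"
    by (simp add: xs_def sum_list_distinct_conv_sum_set)
  finally show ?thesis .
qed

theorem theorem1:
  shows "weak_conv_m (\<lambda>n. empirical_measure n (normalized_zero n)) semicircle"
proof -
  let ?M = "\<lambda>n. empirical_measure n (normalized_zero n)"
  \<comment> \<open>The index is shifted because \<open>?M 0\<close> is the zero measure and not a
    probability distribution.\<close>
  have "weak_conv_m (\<lambda>n. ?M (Suc n)) semicircle"
  proof (rule integral_bdd_continuous_conv_imp_weak_conv)
    show "real_distribution (?M (Suc n))" for n
      by (rule real_distribution_empirical_measure) simp
    show "real_distribution semicircle"
      by (rule real_distribution_semicircle)
    fix f :: "real \<Rightarrow> real" assume "\<And>x. isCont f x"
    then have f: "continuous_on S f" for S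
      by (simp add: continuous_at_imp_continuous_on)
    have "integral\<^sup>L (?M n) f = hermite.average n f" for n
    proof -
      \<comment> \<open>The image has \<open>n\<close> elements, as many as
        \<open>hermite_zeros n\<close>, so scaling merges no zeros.\<close>
      have "inj_on (\<lambda>x. x / (2 * sqrt (real n))) (hermite_zeros n)"
        by (rule eq_card_imp_inj_on) (simp_all add: card_hermite_zeros hermite.card_T)
      then show ?thesis
        using borel_measurable_continuous_onI[OF f]
        by (simp add: integral_empirical_measure sum_normalized_zero[unfolded One_nat_def] hermite.average_def sum.reindex)
    qed
    then show "(\<lambda>n. integral\<^sup>L (?M (Suc n)) f) \<longlonglongrightarrow> integral\<^sup>L semicircle f"
      using LIMSEQ_Suc[OF hermite.average_tendsto[OF f]] integral_semicircle[OF f] by simp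
  qed
  then show ?thesis
    unfolding weak_conv_m_def weak_conv_def by (simp add: LIMSEQ_imp_Suc)
qed

end
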